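(* Let $N_1,N_2,N_3$ be pairwise disjoint finite index sets, $n_i=|N_i|$, and let $\mu,\lambda,\sigma$ be three distinct real coefficients and $\beta\in\mathbb R$. Consider the 0/1 knapsack problem with three distinct coefficients $$\sum_{j\in N_1}\mu x_j+\sum_{j\in N_2}\lambda x_j+\sum_{j\in N_3}\sigma x_j\le\beta,\qquad x\in\{0,1\}^{|N_1|+|N_2|+|N_3|}.$$ Let $v^1,\dots,v^p\in\{0,1\}^{|N_1|+|N_2|+|N_3|}$ be the vertices of the aggregated polyhedron of this problem (defined in the context). Then a complete description of the knapsack problem in an extended space is given by the following system in the variables $x,y\in\mathbb R^{|N_1|+|N_2|+|N_3|}$ and $z\in\mathbb R^p$: $$y=\sum_{j=1}^p v^jz_j,\qquad \sum_{j=1}^pz_j=1,\qquad z_j\ge0\ \ (j=1,\dots,p),$$ $$\sum_{j\in N_i}x^{N_i}_j=\sum_{k=1}^{n_i}k\,y^{N_i,k}\qquad\text{for } i=1,2,3,$$ $$\sum_{j\in T}x^{N_i}_j\ \ge\sum_{\substack{k\in\{1,\dots,n_i\}:\\ |T|+k>n_i}}(|T|+k-n_i)\,y^{N_i,k}\qquad\text{for } i=1,2,3\text{ and }\emptyset\ne T\subset N_i .$$ That is, the convex hull of the feasible 0/1 solutions $x$ of the knapsack problem equals the projection onto the $x$-space of the set of all $(x,y,z)$ satisfying this system.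
   Context: Notation: $x=(x^{N_1},x^{N_2},x^{N_3})$ with $x^{N_i}=(x^{N_i}_j)_{j\in N_i}=(x_j)_{j\in N_i}$, and $y=(y^{N_1},y^{N_2},y^{N_3})$ with $y^{N_i}=(y^{N_i,1},\dots,y^{N_i,n_i})$. The aggregated polyhedron of the knapsack problem is the convex hull of the set of all $y$ with $$\mu\sum_{k=1}^{|N_1|}k\,y^{N_1,k}+\lambda\sum_{k=1}^{|N_2|}k\,y^{N_2,k}+\sigma\sum_{k=1}^{|N_3|}k\,y^{N_3,k}\le\beta,$$ $$\sum_{k=1}^{|N_i|}y^{N_i,k}\le1\ \ (i=1,2,3),\qquad y^{N_i}\in\{0,1\}^{|N_i|}\ \ (i=1,2,3).$$ It has $p\le(1+|N_1|)(1+|N_2|)(1+|N_3|)$ vertices, denoted $v^1,\dots,v^p$. *)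

theory Defs
  imports "HOL-Analysis.Analysis" "HOL-Analysis.Finite_Function_Topology"
begin

text \<open>
  \<open>coord_space I\<close> represents the space of real vectors indexed by the finite set \<open>I\<close>, as the
  subspace of the real vector space of finitely supported functions consisting of those that
  vanish outside \<open>I\<close>. Convex hulls and extreme points do not depend on the ambient space, so the
  library notions carry their usual meaning on it.
\<close>

definition coord_space :: "'i set \<Rightarrow> ('i \<Rightarrow>\<^sub>0 real) set" where
  "coord_space I = {f. Poly_Mapping.keys f \<subseteq> I}"

definition binary_vectors :: "'i set \<Rightarrow> ('i \<Rightarrow>\<^sub>0 real) set" where
  "binary_vectors I = {f \<in> coord_space I. \<forall>i\<in>I. Poly_Mapping.lookup f i \<in> {0, 1}}"

definition knapsack_solutions ::
  "'a set \<Rightarrow> 'a set \<Rightarrow> 'a set \<Rightarrow> real \<Rightarrow> real \<Rightarrow> real \<Rightarrow> real \<Rightarrow> ('a \<Rightarrow>\<^sub>0 real) set" where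
  "knapsack_solutions N1 N2 N3 \<mu> lam \<sigma> \<beta> =
    {x \<in> binary_vectors (N1 \<union> N2 \<union> N3).
      (\<Sum>j\<in>N1. \<mu> * Poly_Mapping.lookup x j) + (\<Sum>j\<in>N2. lam * Poly_Mapping.lookup x j)
        + (\<Sum>j\<in>N3. \<sigma> * Poly_Mapping.lookup x j) \<le> \<beta>}"

text \<open>
  A vector \<open>y\<close> is a triple of blocks; only the sizes \<open>n1\<close>, \<open>n2\<close>, \<open>n3\<close> of the index sets matter
  for the aggregated problem, and block \<open>i\<close> has the coordinates \<open>1, \<dots>, ni\<close>.
\<close>

type_synonym blocks = "(nat \<Rightarrow>\<^sub>0 real) \<times> (nat \<Rightarrow>\<^sub>0 real) \<times> (nat \<Rightarrow>\<^sub>0 real)"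

definition weighted_sum :: "nat \<Rightarrow> (nat \<Rightarrow>\<^sub>0 real) \<Rightarrow> real" where
  "weighted_sum n u = (\<Sum>k=1..n. real k * Poly_Mapping.lookup u k)"

definition selector_vectors :: "nat \<Rightarrow> (nat \<Rightarrow>\<^sub>0 real) set" where
  "selector_vectors n =
    {u \<in> binary_vectors {1..n}. (\<Sum>k=1..n. Poly_Mapping.lookup u k) \<le> 1}"

definition aggregated_solutions ::
  "nat \<Rightarrow> nat \<Rightarrow> nat \<Rightarrow> real \<Rightarrow> real \<Rightarrow> real \<Rightarrow> real \<Rightarrow> blocks set" where
  "aggregated_solutions n1 n2 n3 \<mu> lam \<sigma> \<beta> =
    {(y1, y2, y3).
      y1 \<in> selector_vectors n1 \<and> y2 \<in> selector_vectors n2 \<and> y3 \<in> selector_vectors n3 \<and>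
      \<mu> * weighted_sum n1 y1 + lam * weighted_sum n2 y2 + \<sigma> * weighted_sum n3 y3 \<le> \<beta>}"

definition aggregated_polyhedron ::
  "nat \<Rightarrow> nat \<Rightarrow> nat \<Rightarrow> real \<Rightarrow> real \<Rightarrow> real \<Rightarrow> real \<Rightarrow> blocks set" where
  "aggregated_polyhedron n1 n2 n3 \<mu> lam \<sigma> \<beta> =
    convex hull (aggregated_solutions n1 n2 n3 \<mu> lam \<sigma> \<beta>)"

definition block_constraints :: "'a set \<Rightarrow> ('a \<Rightarrow>\<^sub>0 real) \<Rightarrow> (nat \<Rightarrow>\<^sub>0 real) \<Rightarrow> bool" where
  "block_constraints N x u \<longleftrightarrow>
    (\<Sum>j\<in>N. Poly_Mapping.lookup x j) = weighted_sum (card N) u \<and>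
    (\<forall>T. T \<noteq> {} \<and> T \<subset> N \<longrightarrow>
      (\<Sum>j\<in>T. Poly_Mapping.lookup x j) \<ge>
      (\<Sum>k\<in>{k \<in> {1..card N}. card T + k > card N}.
        (real (card T) + real k - real (card N)) * Poly_Mapping.lookup u k))"

definition extended_system ::
  "'a set \<Rightarrow> 'a set \<Rightarrow> 'a set \<Rightarrow> nat \<Rightarrow> (nat \<Rightarrow> blocks)
    \<Rightarrow> (('a \<Rightarrow>\<^sub>0 real) \<times> blocks \<times> (nat \<Rightarrow>\<^sub>0 real)) set" where
  "extended_system N1 N2 N3 p v =
    {(x, (y1, y2, y3), z).
      x \<in> coord_space (N1 \<union> N2 \<union> N3) \<and>
      y1 \<in> coord_space {1..card N1} \<and> y2 \<in> coord_space {1..card N2} \<and>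
      y3 \<in> coord_space {1..card N3} \<and> z \<in> coord_space {1..p} \<and>
      (y1, y2, y3) = (\<Sum>j=1..p. Poly_Mapping.lookup z j *\<^sub>R v j) \<and>
      (\<Sum>j=1..p. Poly_Mapping.lookup z j) = 1 \<and>
      (\<forall>j\<in>{1..p}. Poly_Mapping.lookup z j \<ge> 0) \<and>
      block_constraints N1 x y1 \<and> block_constraints N2 x y2 \<and> block_constraints N3 x y3}"

end

theory Submission
  imports Defs
begin

text \<open>
  A 0/1 vector is feasible exactly when the numbers of ones in its three blocks form a feasible
  triple \<open>(a, b, c)\<close>, and such triples are encoded by the points of the aggregated problem: the
  block \<open>selector k\<close> is the \<open>k\<close>-th unit vector, or zero for \<open>k = 0\<close>. Since these points are
  binary, all of them are vertices of the aggregated polyhedron. So every 0/1 solution satisfies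
  the system, with \<open>z\<close> a unit vector (\<open>block_constraints_selector\<close>), and the inclusion of the
  hull follows because the system is convex.

  For the converse, let \<open>layer N k\<close> be the set of 0/1 vectors on \<open>N\<close> with \<open>k\<close> ones. The essential
  point is that \<open>block_constraints N x u\<close> forces \<open>x\<close> to be a combination
  \<open>\<Sum>k. u k *\<^sub>R c k\<close> with \<open>c k\<close> in the convex hull of \<open>layer N k\<close> (\<open>block_decomposition\<close>). Indeed,
  order \<open>N\<close> so that \<open>x\<close> decreases, and let \<open>w\<close> be the combination in which \<open>c k\<close> is the indicator
  of the first \<open>k\<close> elements. The constraints, taken for the tails \<open>T\<close> of this order, say that the
  partial sums of \<open>x\<close> are at most those of \<open>w\<close>, with equality for the total. So \<open>w\<close> majorizes
  \<open>x\<close>, and by the argument of Hardy, Littlewood and Polya finitely many transfers from a larger to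
  a smaller coordinate lead from \<open>w\<close> to \<open>x\<close> (\<open>majorized_by_transfers\<close>). A transfer
  is a convex combination of the identity and of a linear transposition, which preserves every
  layer, so the set of all such combinations is closed under transfers.

  Finally, if \<open>y = \<Sum>j. z j *\<^sub>R v j\<close> and the vertex \<open>v j\<close> encodes the triple
  \<open>(a j, b j, c j)\<close>, regrouping the three decompositions by \<open>j\<close> writes \<open>x\<close> as the convex
  combination, with the weights \<open>z j\<close>, of sums of hull points of the layers \<open>a j\<close>, \<open>b j\<close> and
  \<open>c j\<close>, and every sum of vectors from these three layers is feasible.
\<close>

section \<open>Coordinate spaces and binary vectors\<close>

lemma lookup_scaleR [simp]:
  "Poly_Mapping.lookup (r *\<^sub>R x) i = r * Poly_Mapping.lookup (x :: 'i \<Rightarrow>\<^sub>0 real) i"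
proof -
  have "finite {i. r * Poly_Mapping.lookup x i \<noteq> 0}"
    by (rule finite_subset[OF _ finite_lookup[of x]]) auto
  then show ?thesis
    by (simp add: scaleR_poly_mapping_def)
qed

lemmas lookup_linear = lookup_add lookup_minus lookup_sum

lemma coord_space_iff:
  "x \<in> coord_space I \<longleftrightarrow> (\<forall>i. i \<notin> I \<longrightarrow> Poly_Mapping.lookup x i = 0)"
  by (auto simp: coord_space_def in_keys_iff)

lemma coord_space_eqI:
  assumes "x \<in> coord_space I" "y \<in> coord_space I"
    and "\<And>i. i \<in> I \<Longrightarrow> Poly_Mapping.lookup x i = Poly_Mapping.lookup y i"
  shows "x = y"
  using assms by (intro poly_mapping_eqI) (metis coord_space_iff)

lemma subspace_coord_space: "subspace (coord_space I :: ('i \<Rightarrow>\<^sub>0 real) set)"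
  by (auto simp: subspace_def coord_space_iff lookup_linear)

lemma restrict_exists:
  fixes x :: "'i \<Rightarrow>\<^sub>0 real"
  assumes "finite I"
  obtains r where "r \<in> coord_space I"
    and "\<And>i. i \<in> I \<Longrightarrow> Poly_Mapping.lookup r i = Poly_Mapping.lookup x i"
proof
  let ?r = "\<Sum>i\<in>I. Poly_Mapping.single i (Poly_Mapping.lookup x i)"
  have *: "Poly_Mapping.lookup ?r i = (if i \<in> I then Poly_Mapping.lookup x i else 0)" for i
    using assms by (simp add: lookup_sum lookup_single when_def)
  show "?r \<in> coord_space I" and "\<And>i. i \<in> I \<Longrightarrow> Poly_Mapping.lookup ?r i = Poly_Mapping.lookup x i"
    by (auto simp: coord_space_iff *)
qed

lemma lookup_in_convex_hull_binary:
  fixes S :: "('i \<Rightarrow>\<^sub>0 real) set"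
  assumes "S \<subseteq> binary_vectors I" and "x \<in> convex hull S"
  shows "0 \<le> Poly_Mapping.lookup x i" and "Poly_Mapping.lookup x i \<le> 1"
proof -
  let ?B = "{x :: 'i \<Rightarrow>\<^sub>0 real. 0 \<le> Poly_Mapping.lookup x i \<and> Poly_Mapping.lookup x i \<le> 1}"
  have "convex ?B"
    by (rule convexI) (simp add: lookup_linear convex_bound_le)
  moreover have "S \<subseteq> ?B"
  proof
    fix f assume "f \<in> S"
    then have "f \<in> binary_vectors I"
      using assms(1) by blast
    then show "f \<in> ?B"
      by (cases "i \<in> I") (auto simp: binary_vectors_def coord_space_iff)
  qed
  ultimately have "convex hull S \<subseteq> ?B"
    by (rule hull_minimal[rotated])
  with assms(2) show "0 \<le> Poly_Mapping.lookup x i" and "Poly_Mapping.lookup x i \<le> 1"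
    by auto
qed

text \<open>
  Because \<open>0\<close> and \<open>1\<close> are the ends of the unit interval, a proper mixture of two of its numbers
  reaches one of them only when both numbers do; this is applied in each coordinate.
\<close>

lemma binary_segment_trivial:
  fixes a b :: "'i \<Rightarrow>\<^sub>0 real"
  assumes a: "\<And>i. 0 \<le> Poly_Mapping.lookup a i \<and> Poly_Mapping.lookup a i \<le> 1"
    and b: "\<And>i. 0 \<le> Poly_Mapping.lookup b i \<and> Poly_Mapping.lookup b i \<le> 1"
    and t: "0 < t" "t < (1 :: real)"
    and bin: "(1 - t) *\<^sub>R a + t *\<^sub>R b \<in> binary_vectors I"
  shows "a = b"
proof (rule poly_mapping_eqI)
  fix i
  let ?a = "Poly_Mapping.lookup a i" and ?b = "Poly_Mapping.lookup b i"
  have "(1 - t) * ?a + t * ?b = 0 \<or> (1 - t) * ?a + t * ?b = 1"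
    using bin by (cases "i \<in> I") (auto simp: binary_vectors_def coord_space_iff lookup_linear)
  then show "?a = ?b"
  proof
    assume *: "(1 - t) * ?a + t * ?b = 0"
    have "0 \<le> (1 - t) * ?a" "0 \<le> t * ?b"
      using a[of i] b[of i] t by auto
    with * have "(1 - t) * ?a = 0" "t * ?b = 0"
      by linarith+
    then show ?thesis
      using t by simp
  next
    assume "(1 - t) * ?a + t * ?b = 1"
    then have *: "(1 - t) * (1 - ?a) + t * (1 - ?b) = 0"
      by (simp add: algebra_simps)
    have "0 \<le> (1 - t) * (1 - ?a)" "0 \<le> t * (1 - ?b)"
      using a[of i] b[of i] t by auto
    with * have "(1 - t) * (1 - ?a) = 0" "t * (1 - ?b) = 0"
      by linarith+
    then show ?thesis
      using t by simp
  qed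
qed

section \<open>The vertices of the aggregated polyhedron\<close>

definition selector :: "nat \<Rightarrow> (nat \<Rightarrow>\<^sub>0 real)" where
  "selector k = (if k = 0 then 0 else Poly_Mapping.single k 1)"

lemma lookup_selector:
  "Poly_Mapping.lookup (selector k) i = (if i = k \<and> k \<noteq> 0 then 1 else 0)"
  by (simp add: selector_def lookup_single when_def)

lemma weighted_sum_selector: "k \<le> n \<Longrightarrow> weighted_sum n (selector k) = real k"
  by (cases "k = 0") (simp_all add: weighted_sum_def lookup_selector if_distrib sum.delta cong: if_cong)

lemma selector_in_selector_vectors: "k \<le> n \<Longrightarrow> selector k \<in> selector_vectors n"
  by (cases "k = 0")
     (simp_all add: selector_vectors_def binary_vectors_def coord_space_iff lookup_selector)

lemma selector_vectorsE:
  assumes "u \<in> selector_vectors n"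
  obtains k where "k \<le> n" "u = selector k"
proof (cases "\<exists>k\<in>{1..n}. Poly_Mapping.lookup u k = 1")
  case True
  then obtain k where k: "k \<in> {1..n}" "Poly_Mapping.lookup u k = 1"
    by blast
  have u: "u \<in> coord_space {1..n}" "\<And>i. i \<in> {1..n} \<Longrightarrow> Poly_Mapping.lookup u i \<in> {0, 1}"
    and le: "(\<Sum>k=1..n. Poly_Mapping.lookup u k) \<le> 1"
    using assms by (auto simp: selector_vectors_def binary_vectors_def)
  have nn: "0 \<le> Poly_Mapping.lookup u i" if "i \<in> {1..n}" for i
    using u(2)[OF that] by auto
  have "(\<Sum>i\<in>{1..n} - {k}. Poly_Mapping.lookup u i) \<le> 0"
    using le k(2) sum.remove[OF _ k(1), of "Poly_Mapping.lookup u"] by simp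
  then have "(\<Sum>i\<in>{1..n} - {k}. Poly_Mapping.lookup u i) = 0"
    using nn by (intro antisym sum_nonneg) auto
  then have zero: "\<And>i. i \<in> {1..n} - {k} \<Longrightarrow> Poly_Mapping.lookup u i = 0"
    using nn by (subst (asm) sum_nonneg_eq_0_iff) auto
  have "u = selector k"
  proof (rule coord_space_eqI[of _ "{1..n}"])
    show "selector k \<in> coord_space {1..n}"
      using k by (auto simp: coord_space_iff lookup_selector)
  qed (use u k zero in \<open>auto simp: lookup_selector\<close>)
  with k show thesis
    by (intro that) auto
next
  case False
  have "u = selector 0"
    using assms False
    by (intro coord_space_eqI[of _ "{1..n}"])
       (auto simp: selector_vectors_def binary_vectors_def coord_space_iff lookup_selector)
  then show thesis
    by (intro that[of 0]) auto
qed

lemma aggregated_solutions_selector: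
  assumes "a \<le> n1" "b \<le> n2" "c \<le> n3"
  shows "(selector a, selector b, selector c) \<in> aggregated_solutions n1 n2 n3 \<mu> lam \<sigma> \<beta>
    \<longleftrightarrow> \<mu> * real a + lam * real b + \<sigma> * real c \<le> \<beta>"
  using assms
  by (simp add: aggregated_solutions_def weighted_sum_selector selector_in_selector_vectors)

lemma aggregated_solutionsE:
  assumes "w \<in> aggregated_solutions n1 n2 n3 \<mu> lam \<sigma> \<beta>"
  obtains a b c where "a \<le> n1" "b \<le> n2" "c \<le> n3" "w = (selector a, selector b, selector c)"
    "\<mu> * real a + lam * real b + \<sigma> * real c \<le> \<beta>"
  using assms
  by (auto simp: aggregated_solutions_def weighted_sum_selector elim!: selector_vectorsE)

lemma selector_vectors_binary: "selector_vectors n \<subseteq> binary_vectors {1..n}"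
  by (auto simp: selector_vectors_def)

lemma extreme_points_aggregated_polyhedron:
  "{w. w extreme_point_of aggregated_polyhedron n1 n2 n3 \<mu> lam \<sigma> \<beta>}
    = aggregated_solutions n1 n2 n3 \<mu> lam \<sigma> \<beta>" (is "?E = ?S")
proof
  show "?E \<subseteq> ?S"
    unfolding aggregated_polyhedron_def by (rule extreme_points_of_convex_hull)
  have hull: "convex hull ?S \<subseteq> (convex hull (binary_vectors {1..n1})) \<times>
      (convex hull (binary_vectors {1..n2})) \<times> (convex hull (binary_vectors {1..n3}))"
    by (intro hull_minimal convex_Times convex_convex_hull)
       (use selector_vectors_binary in \<open>auto simp: aggregated_solutions_def intro!: hull_inc\<close>)
  \<comment> \<open>Conversely, a binary vector is not strictly inside a segment of the unit cube.\<close>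
  show "?S \<subseteq> ?E"
  proof
    fix w assume w: "w \<in> ?S"
    have bin: "fst w \<in> binary_vectors {1..n1}" "fst (snd w) \<in> binary_vectors {1..n2}"
        "snd (snd w) \<in> binary_vectors {1..n3}"
      using w by (auto simp: aggregated_solutions_def selector_vectors_def)
    have "w \<notin> open_segment a b" if ab: "a \<in> convex hull ?S" "b \<in> convex hull ?S" for a b
    proof
      assume "w \<in> open_segment a b"
      then obtain t where ne: "a \<noteq> b" and t: "0 < t" "t < 1" "w = (1 - t) *\<^sub>R a + t *\<^sub>R b"
        by (auto simp: in_segment)
      note bounds = lookup_in_convex_hull_binary[OF order.refl]
      have "fst a = fst b"
        using ab hull bin(1) t
        by (intro binary_segment_trivial[of _ _ t "{1..n1}"])
           (auto intro!: bounds[where I = "{1..n1}"])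
      moreover have "fst (snd a) = fst (snd b)"
        using ab hull bin(2) t
        by (intro binary_segment_trivial[of _ _ t "{1..n2}"])
           (auto intro!: bounds[where I = "{1..n2}"])
      moreover have "snd (snd a) = snd (snd b)"
        using ab hull bin(3) t
        by (intro binary_segment_trivial[of _ _ t "{1..n3}"])
           (auto intro!: bounds[where I = "{1..n3}"])
      ultimately show False
        using ne by (simp add: prod_eq_iff)
    qed
    then show "w \<in> ?E"
      using w by (auto simp: extreme_point_of_def aggregated_polyhedron_def intro: hull_inc)
  qed
qed

section \<open>Majorization by transfers\<close>

text \<open>
  Since \<open>x\<close> decreases along \<open>e\<close>, a position \<open>k\<close> where \<open>f\<close> is too small and an earlier position
  \<open>j\<close> where \<open>f\<close> is too large satisfy \<open>f j > x j \<ge> x k > f k\<close>, so a transfer that corrects one of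
  the two coordinates completely is admissible. When \<open>k\<close> is the first position where \<open>f\<close> is too
  small, the surplus of the partial sums of \<open>f\<close> over those of \<open>x\<close> does not decrease before \<open>k\<close>, so
  it is at least \<open>f j - x j\<close> between \<open>j\<close> and \<open>k\<close> and the transfer preserves the hypothesis on
  partial sums. Each transfer lowers the number of wrong coordinates.
\<close>

lemma majorized_by_transfers:
  fixes x f :: "'a \<Rightarrow>\<^sub>0 real" and e :: "nat \<Rightarrow> 'a"
  assumes e: "bij_betw e {..<n} N"
    and x: "x \<in> coord_space N"
    and decr: "\<And>i j. i \<le> j \<Longrightarrow> j < n \<Longrightarrow>
      Poly_Mapping.lookup x (e j) \<le> Poly_Mapping.lookup x (e i)"
    and M: "M \<subseteq> coord_space N"
    and transfer: "\<And>f a b d. \<lbrakk>f \<in> M; a \<in> N; b \<in> N; 0 \<le> d;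
        d \<le> Poly_Mapping.lookup f a - Poly_Mapping.lookup f b\<rbrakk>
      \<Longrightarrow> f - d *\<^sub>R (Poly_Mapping.single a 1 - Poly_Mapping.single b 1) \<in> M"
    and "f \<in> M"
    and "\<And>m. m \<le> n \<Longrightarrow>
      (\<Sum>i<m. Poly_Mapping.lookup x (e i)) \<le> (\<Sum>i<m. Poly_Mapping.lookup f (e i))"
    and "(\<Sum>i<n. Poly_Mapping.lookup x (e i)) = (\<Sum>i<n. Poly_Mapping.lookup f (e i))"
  shows "x \<in> M"
  using assms(6-8)
proof (induction "card {i. i < n \<and> Poly_Mapping.lookup x (e i) \<noteq> Poly_Mapping.lookup f (e i)}"
    arbitrary: f rule: less_induct)
  case less
  define X where "X i = Poly_Mapping.lookup x (e i)" for i
  define F where "F i = Poly_Mapping.lookup f (e i)" for i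
  have partial: "m \<le> n \<Longrightarrow> sum X {..<m} \<le> sum F {..<m}" for m
    using less.prems(2) by (simp add: X_def F_def)
  have total: "sum X {..<n} = sum F {..<n}"
    using less.prems(3) by (simp add: X_def F_def)
  show ?case
  proof (cases "\<forall>i<n. F i \<ge> X i")
    case True
    have "(\<Sum>i<n. F i - X i) = 0"
      using total by (simp add: sum_subtractf)
    then have "\<And>i. i < n \<Longrightarrow> F i = X i"
      using True by (subst (asm) sum_nonneg_eq_0_iff) auto
    then have "x = f"
      using x M \<open>f \<in> M\<close> e
      by (intro coord_space_eqI[of _ N]) (auto simp: X_def F_def bij_betw_def)
    with \<open>f \<in> M\<close> show ?thesis
      by simp
  next
    case False
    define k where "k = (LEAST i. i < n \<and> F i < X i)"
    have k: "k < n" "F k < X k"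
      using False LeastI_ex[of "\<lambda>i. i < n \<and> F i < X i"] unfolding k_def by force+
    have before: "X i \<le> F i" if "i < k" for i
      using not_less_Least[of i "\<lambda>i. i < n \<and> F i < X i"] that k(1) unfolding k_def by force
    have "\<exists>j<k. X j < F j"
    proof (rule ccontr)
      assume "\<not> ?thesis"
      then have "sum F {..<k} \<le> sum X {..<k}"
        by (intro sum_mono) force
      then show False
        using partial[of "Suc k"] k by simp
    qed
    then obtain j where j: "j < k" "X j < F j"
      by blast
    have jn: "j < n"
      using j k by simp
    have Xjk: "X k \<le> X j"
      using decr[of j k] j k by (simp add: X_def)
    define d where "d = min (F j - X j) (X k - F k)"
    define g where "g = f - d *\<^sub>R (Poly_Mapping.single (e j) 1 - Poly_Mapping.single (e k) 1)"
    define G where "G i = Poly_Mapping.lookup g (e i)" for i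
    have d: "0 < d" "d \<le> F j - X j" "d \<le> X k - F k" "d = F j - X j \<or> d = X k - F k"
      using j k by (auto simp: d_def)
    have inj: "e i = e i' \<longleftrightarrow> i = i'" if "i < n" "i' < n" for i i'
      using e that by (auto simp: bij_betw_def inj_on_def)
    have G: "G i = F i - (if i = j then d else 0) + (if i = k then d else 0)" if "i < n" for i
      using inj[OF that jn] inj[OF that k(1)] inj[OF jn that] inj[OF k(1) that]
      by (auto simp: G_def g_def F_def lookup_linear lookup_single when_def)
    have sumG: "sum G {..<m} = sum F {..<m} - (if j < m then d else 0) + (if k < m then d else 0)"
      if "m \<le> n" for m
      using that by (simp add: G sum.distrib sum_subtractf)
    have "g \<in> M"
      unfolding g_def using e j k jn d Xjk \<open>f \<in> M\<close>
      by (intro transfer) (auto simp: bij_betw_def F_def)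
    moreover have "sum X {..<m} \<le> sum G {..<m}" if m: "m \<le> n" for m
    proof (cases "j < m \<and> m \<le> k")
      case True
      have "F j - X j \<le> (\<Sum>i<m. F i - X i)"
        using True before by (intro member_le_sum) auto
      then show ?thesis
        using sumG[OF m] True d by (simp add: sum_subtractf)
    next
      case False
      then show ?thesis
        using sumG[OF m] partial[OF m] j by auto
    qed
    moreover have "sum X {..<n} = sum G {..<n}"
      using sumG[of n] total jn k by simp
    moreover have "card {i. i < n \<and> X i \<noteq> G i} < card {i. i < n \<and> X i \<noteq> F i}"
    proof (rule psubset_card_mono)
      show "{i. i < n \<and> X i \<noteq> G i} \<subset> {i. i < n \<and> X i \<noteq> F i}"
      proof
        show "{i. i < n \<and> X i \<noteq> G i} \<subseteq> {i. i < n \<and> X i \<noteq> F i}"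
          using G j k by (auto split: if_splits)
        show "{i. i < n \<and> X i \<noteq> G i} \<noteq> {i. i < n \<and> X i \<noteq> F i}"
          using d(4)
        proof
          assume "d = F j - X j"
          then have "G j = X j"
            using G[OF jn] j by simp
          then have "j \<notin> {i. i < n \<and> X i \<noteq> G i}" "j \<in> {i. i < n \<and> X i \<noteq> F i}"
            using j jn by auto
          then show ?thesis
            by blast
        next
          assume "d = X k - F k"
          then have "G k = X k"
            using G[OF k(1)] j by simp
          then have "k \<notin> {i. i < n \<and> X i \<noteq> G i}" "k \<in> {i. i < n \<and> X i \<noteq> F i}"
            using k by auto
          then show ?thesis
            by blast
        qed
      qed
    qed simp
    ultimately show ?thesis
      using less.hyps[of g] by (simp add: X_def F_def G_def)
  qed
qed

section \<open>Decomposing one block into layers\<close>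

definition layer :: "'a set \<Rightarrow> nat \<Rightarrow> ('a \<Rightarrow>\<^sub>0 real) set" where
  "layer N k = {f \<in> binary_vectors N. (\<Sum>j\<in>N. Poly_Mapping.lookup f j) = real k}"

definition layer_combinations :: "'a set \<Rightarrow> (nat \<Rightarrow>\<^sub>0 real) \<Rightarrow> ('a \<Rightarrow>\<^sub>0 real) set" where
  "layer_combinations N u =
    {\<Sum>k=1..card N. Poly_Mapping.lookup u k *\<^sub>R c k | c. \<forall>k\<le>card N. c k \<in> convex hull (layer N k)}"

lemma convex_hull_layer_coord_space: "convex hull (layer N k) \<subseteq> coord_space N"
  by (intro hull_minimal subspace_imp_convex subspace_coord_space)
     (auto simp: layer_def binary_vectors_def)

lemma layer_zero:
  assumes "finite N"
  shows "convex hull (layer N 0) \<subseteq> {0}"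
proof -
  have "f = 0" if f: "f \<in> layer N 0" for f
  proof (rule coord_space_eqI[of _ N])
    have "\<And>i. i \<in> N \<Longrightarrow> 0 \<le> Poly_Mapping.lookup f i"
      using f by (force simp: layer_def binary_vectors_def)
    then show "\<And>i. i \<in> N \<Longrightarrow> Poly_Mapping.lookup f i = Poly_Mapping.lookup 0 i"
      using f assms by (simp add: layer_def sum_nonneg_eq_0_iff)
  qed (use f in \<open>auto simp: layer_def binary_vectors_def coord_space_iff\<close>)
  then show ?thesis
    by (intro hull_minimal) auto
qed

text \<open>
  The exchange of the coordinates \<open>a\<close> and \<open>b\<close>, written as a reflection so that its linearity and
  its relation to transfers are evident.
\<close>

definition exchange :: "'a \<Rightarrow> 'a \<Rightarrow> ('a \<Rightarrow>\<^sub>0 real) \<Rightarrow> ('a \<Rightarrow>\<^sub>0 real)" where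
  "exchange a b f = f - (Poly_Mapping.lookup f a - Poly_Mapping.lookup f b) *\<^sub>R
    (Poly_Mapping.single a 1 - Poly_Mapping.single b 1)"

lemma linear_exchange: "linear (exchange a b)"
  by (rule linearI) (simp_all add: exchange_def lookup_linear algebra_simps)

lemma lookup_exchange:
  "Poly_Mapping.lookup (exchange a b f) i = Poly_Mapping.lookup f (Transposition.transpose a b i)"
  by (auto simp: exchange_def lookup_linear lookup_single when_def Transposition.transpose_def)

lemma exchange_hull_layer:
  assumes "a \<in> N" "b \<in> N" and "f \<in> convex hull (layer N k)"
  shows "exchange a b f \<in> convex hull (layer N k)"
proof -
  have tr: "Transposition.transpose a b i \<in> N \<longleftrightarrow> i \<in> N" for i
    using assms(1,2) by (auto simp: Transposition.transpose_def)
  have "exchange a b f \<in> layer N k" if f: "f \<in> layer N k" for f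
  proof -
    have "(\<Sum>j\<in>N. Poly_Mapping.lookup (exchange a b f) j) = (\<Sum>j\<in>N. Poly_Mapping.lookup f j)"
      unfolding lookup_exchange
      by (rule sum.reindex_bij_witness[of _ "Transposition.transpose a b" "Transposition.transpose a b"]) (auto simp: tr)
    then show ?thesis
      using f tr by (auto simp: layer_def binary_vectors_def coord_space_iff lookup_exchange)
  qed
  then have "exchange a b ` layer N k \<subseteq> layer N k"
    by blast
  then have "convex hull (exchange a b ` layer N k) \<subseteq> convex hull (layer N k)"
    by (rule hull_mono)
  then show ?thesis
    using assms(3) convex_hull_linear_image[OF linear_exchange, of a b "layer N k"] by auto
qed

text \<open>
  Moving \<open>d\<close> from \<open>a\<close> to \<open>b\<close> goes a part \<open>t\<close> of the way from \<open>f\<close> to its exchange. By linearity the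
  same mixture can be applied to each \<open>c k\<close> separately.
\<close>

lemma layer_combinations_transfer:
  assumes f: "f \<in> layer_combinations N u" and ab: "a \<in> N" "b \<in> N"
    and d: "0 \<le> d" "d \<le> Poly_Mapping.lookup f a - Poly_Mapping.lookup f b"
  shows "f - d *\<^sub>R (Poly_Mapping.single a 1 - Poly_Mapping.single b 1) \<in> layer_combinations N u"
proof (cases "d = 0")
  case True
  with f show ?thesis by simp
next
  case False
  define t where "t = d / (Poly_Mapping.lookup f a - Poly_Mapping.lookup f b)"
  have t: "0 \<le> t" "t \<le> 1" "t * (Poly_Mapping.lookup f a - Poly_Mapping.lookup f b) = d"
    using d False by (auto simp: t_def)
  obtain c where c: "\<And>k. k \<le> card N \<Longrightarrow> c k \<in> convex hull (layer N k)"
    and fc: "f = (\<Sum>k=1..card N. Poly_Mapping.lookup u k *\<^sub>R c k)"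
    using f by (auto simp: layer_combinations_def)
  have "f - d *\<^sub>R (Poly_Mapping.single a 1 - Poly_Mapping.single b 1)
      = (1 - t) *\<^sub>R f + t *\<^sub>R exchange a b f"
    unfolding exchange_def t(3)[symmetric] by (simp add: algebra_simps)
  also have "\<dots> = (\<Sum>k=1..card N. Poly_Mapping.lookup u k *\<^sub>R
      ((1 - t) *\<^sub>R c k + t *\<^sub>R exchange a b (c k)))"
    unfolding fc
    by (simp add: linear_sum[OF linear_exchange] linear_cmul[OF linear_exchange]
        scaleR_sum_right scaleR_add_right sum.distrib mult.commute)
  also have "\<dots> \<in> layer_combinations N u"
    unfolding layer_combinations_def using t c ab
    by (intro CollectI exI[of _ "\<lambda>k. (1 - t) *\<^sub>R c k + t *\<^sub>R exchange a b (c k)"] conjI refl allI impI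
        convexD[OF convex_convex_hull] exchange_hull_layer) auto
  finally show ?thesis .
qed

lemma decreasing_enumeration:
  fixes h :: "'a \<Rightarrow> real"
  assumes "finite N"
  obtains e where "bij_betw e {..<card N} N"
    and "\<And>i j. i \<le> j \<Longrightarrow> j < card N \<Longrightarrow> h (e j) \<le> h (e i)"
proof -
  obtain l where l: "set l = N" "distinct l"
    using finite_distinct_list[OF assms] by blast
  define s where "s = sort_key (\<lambda>a. - h a) l"
  have s: "set s = N" "distinct s" "length s = card N" "sorted (map (\<lambda>a. - h a) s)"
    using l by (auto simp: s_def distinct_card)
  show thesis
  proof
    show "bij_betw ((!) s) {..<card N} N"
      using s by (intro bij_betw_nth) auto
    show "h (s ! j) \<le> h (s ! i)" if "i \<le> j" "j < card N" for i j
      using sorted_nth_mono[OF s(4) that(1)] that s(3) by simp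
  qed
qed

text \<open>
  The bound on the first \<open>m\<close> coordinates is the constraint for the complementary tail \<open>T\<close>,
  subtracted from the total, because \<open>k - max 0 (|T| + k - n) = min k m\<close>.
\<close>

lemma block_constraints_prefix:
  assumes N: "finite N" and e: "bij_betw e {..<card N} N"
    and block: "block_constraints N x u" and m: "m \<le> card N"
  shows "(\<Sum>i<m. Poly_Mapping.lookup x (e i))
    \<le> (\<Sum>k=1..card N. Poly_Mapping.lookup u k * real (min k m))"
proof -
  let ?n = "card N"
  define T where "T = e ` {m..<?n}"
  have inj: "inj_on e {..<?n}" and img: "e ` {..<?n} = N"
    using e by (auto simp: bij_betw_def)
  have cardT: "card T = ?n - m"
    unfolding T_def by (subst card_image) (auto intro: inj_on_subset[OF inj])
  have total: "(\<Sum>i<?n. Poly_Mapping.lookup x (e i))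
      = (\<Sum>k=1..?n. Poly_Mapping.lookup u k * real k)"
    using block sum.reindex_bij_betw[OF e, of "Poly_Mapping.lookup x"]
    by (simp add: block_constraints_def weighted_sum_def mult.commute)
  have sumT: "(\<Sum>j\<in>T. Poly_Mapping.lookup x j) = (\<Sum>i=m..<?n. Poly_Mapping.lookup x (e i))"
    unfolding T_def by (subst sum.reindex) (auto intro: inj_on_subset[OF inj])
  have split: "(\<Sum>i<?n. Poly_Mapping.lookup x (e i))
      = (\<Sum>i<m. Poly_Mapping.lookup x (e i)) + (\<Sum>i=m..<?n. Poly_Mapping.lookup x (e i))"
    using sum.atLeastLessThan_concat[of 0 m ?n "\<lambda>i. Poly_Mapping.lookup x (e i)"] m
    by (simp add: atLeast0LessThan)
  consider "m = 0" | "m = ?n" | "0 < m" "m < ?n"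
    using m by linarith
  then show ?thesis
  proof cases
    case 1
    then show ?thesis by simp
  next
    case 2
    then show ?thesis
      using total by (simp add: min_def)
  next
    case 3
    have "T \<noteq> {}"
      using 3 by (auto simp: T_def)
    moreover have "T \<subseteq> N"
      using img by (auto simp: T_def)
    moreover have "T \<noteq> N"
      using cardT 3 by auto
    ultimately have "(\<Sum>k\<in>{k \<in> {1..?n}. card T + k > ?n}.
        (real (card T) + real k - real ?n) * Poly_Mapping.lookup u k)
        \<le> (\<Sum>j\<in>T. Poly_Mapping.lookup x j)"
      using block by (auto simp: block_constraints_def)
    moreover have "(\<Sum>k\<in>{k \<in> {1..?n}. card T + k > ?n}.
        (real (card T) + real k - real ?n) * Poly_Mapping.lookup u k)
      = (\<Sum>k=1..?n. Poly_Mapping.lookup u k * (real k - real (min k m)))"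
      using 3 cardT by (intro sum.mono_neutral_cong_left) (auto simp: min_def of_nat_diff)
    moreover have "(\<Sum>k=1..?n. Poly_Mapping.lookup u k * (real k - real (min k m)))
      = (\<Sum>k=1..?n. Poly_Mapping.lookup u k * real k)
        - (\<Sum>k=1..?n. Poly_Mapping.lookup u k * real (min k m))"
      by (simp add: right_diff_distrib sum_subtractf)
    ultimately show ?thesis
      using total sumT split by linarith
  qed
qed

text \<open>
  The starting point \<open>w\<close> of the transfers has, at position \<open>i\<close>, the sum of the \<open>u k\<close> with
  \<open>k > i\<close>; its partial sums are exactly the bounds of \<open>block_constraints_prefix\<close>.
\<close>

lemma block_decomposition:
  assumes N: "finite N" and x: "x \<in> coord_space N" and block: "block_constraints N x u"
  shows "x \<in> layer_combinations N u"
proof -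
  let ?n = "card N"
  obtain e where e: "bij_betw e {..<?n} N"
    and decr: "\<And>i j. i \<le> j \<Longrightarrow> j < ?n \<Longrightarrow>
      Poly_Mapping.lookup x (e j) \<le> Poly_Mapping.lookup x (e i)"
    using decreasing_enumeration[OF N, of "Poly_Mapping.lookup x"] by blast
  have inj: "e i = e i' \<longleftrightarrow> i = i'" if "i < ?n" "i' < ?n" for i i'
    using e that by (auto simp: bij_betw_def inj_on_def)
  define c where "c k = (\<Sum>i<k. Poly_Mapping.single (e i) (1 :: real))" for k
  have lookup_c: "Poly_Mapping.lookup (c k) (e i) = (if i < k then 1 else 0)"
    if "k \<le> ?n" "i < ?n" for i k
  proof -
    have "Poly_Mapping.lookup (c k) (e i) = (\<Sum>i'<k. if i' = i then 1 else 0)"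
      unfolding c_def lookup_sum
      by (intro sum.cong) (use inj that in \<open>auto simp: lookup_single when_def\<close>)
    then show ?thesis by simp
  qed
  have c_layer: "c k \<in> layer N k" if "k \<le> ?n" for k
  proof -
    have "c k \<in> coord_space N"
      unfolding c_def using e that
      by (intro subspace_sum subspace_coord_space)
         (auto simp: coord_space_iff lookup_single when_def bij_betw_def)
    moreover have "Poly_Mapping.lookup (c k) j \<in> {0, 1}" if j: "j \<in> N" for j
    proof -
      obtain i where "i < ?n" "j = e i"
        using e j by (auto simp: bij_betw_def)
      then show ?thesis
        using lookup_c[OF \<open>k \<le> ?n\<close>] by simp
    qed
    moreover have "(\<Sum>j\<in>N. Poly_Mapping.lookup (c k) j) = real k"
    proof -
      have "(\<Sum>j\<in>N. Poly_Mapping.lookup (c k) j) = (\<Sum>i<?n. if i < k then 1 else 0)"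
        using sum.reindex_bij_betw[OF e, of "Poly_Mapping.lookup (c k)"] lookup_c[OF that] by simp
      also have "\<dots> = (\<Sum>i<k. 1)"
        using that by (intro sum.mono_neutral_cong_right) auto
      finally show ?thesis by simp
    qed
    ultimately show ?thesis
      by (auto simp: layer_def binary_vectors_def)
  qed
  define w where "w = (\<Sum>k=1..?n. Poly_Mapping.lookup u k *\<^sub>R c k)"
  have w_prefix: "(\<Sum>i<m. Poly_Mapping.lookup w (e i))
      = (\<Sum>k=1..?n. Poly_Mapping.lookup u k * real (min k m))" if m: "m \<le> ?n" for m
  proof -
    have "(\<Sum>i<m. Poly_Mapping.lookup w (e i))
        = (\<Sum>k=1..?n. Poly_Mapping.lookup u k * (\<Sum>i<m. Poly_Mapping.lookup (c k) (e i)))"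
      unfolding w_def lookup_sum lookup_scaleR sum_distrib_left by (rule sum.swap)
    also have "\<dots> = (\<Sum>k=1..?n. Poly_Mapping.lookup u k * real (min k m))"
    proof (rule sum.cong)
      fix k assume "k \<in> {1..?n}"
      then have "(\<Sum>i<m. Poly_Mapping.lookup (c k) (e i)) = (\<Sum>i<m. if i < k then 1 else 0)"
        using m lookup_c by (intro sum.cong) auto
      also have "\<dots> = (\<Sum>i<min k m. 1)"
        by (intro sum.mono_neutral_cong_right) auto
      finally show "Poly_Mapping.lookup u k * (\<Sum>i<m. Poly_Mapping.lookup (c k) (e i))
          = Poly_Mapping.lookup u k * real (min k m)"
        by simp
    qed simp
    finally show ?thesis .
  qed
  have total: "(\<Sum>i<?n. Poly_Mapping.lookup x (e i)) = (\<Sum>i<?n. Poly_Mapping.lookup w (e i))"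
  proof -
    have "(\<Sum>i<?n. Poly_Mapping.lookup x (e i)) = (\<Sum>k=1..?n. Poly_Mapping.lookup u k * real k)"
      using block sum.reindex_bij_betw[OF e, of "Poly_Mapping.lookup x"]
      by (simp add: block_constraints_def weighted_sum_def mult.commute)
    also have "\<dots> = (\<Sum>i<?n. Poly_Mapping.lookup w (e i))"
      by (subst w_prefix) (auto simp: min_def intro!: sum.cong)
    finally show ?thesis .
  qed
  show ?thesis
  proof (rule majorized_by_transfers[where M = "layer_combinations N u", OF e x decr])
    show "layer_combinations N u \<subseteq> coord_space N"
      using convex_hull_layer_coord_space[of N]
      by (force simp: layer_combinations_def
          intro!: subspace_sum subspace_mul subspace_coord_space)
    show "w \<in> layer_combinations N u"
      using c_layer by (auto simp: layer_combinations_def w_def intro!: exI[of _ c] hull_inc)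
    show "(\<Sum>i<m. Poly_Mapping.lookup x (e i)) \<le> (\<Sum>i<m. Poly_Mapping.lookup w (e i))"
      if "m \<le> ?n" for m
      using block_constraints_prefix[OF N e block that] w_prefix[OF that] by simp
  qed (use total layer_combinations_transfer in auto)
qed

text \<open>
  The form in which the decomposition is used: the multipliers \<open>u\<close> come from a combination of
  selectors. The summands with \<open>a j = 0\<close> appear here although \<open>u\<close> has no coordinate \<open>0\<close>; this
  is harmless because \<open>layer N 0\<close> contains only the zero vector.
\<close>

lemma block_decomposition_selectors:
  fixes z :: "'j \<Rightarrow> real"
  assumes N: "finite N" and block: "block_constraints N x u"
    and u: "u = (\<Sum>j\<in>J. z j *\<^sub>R selector (a j))" and a: "\<And>j. j \<in> J \<Longrightarrow> a j \<le> card N"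
  obtains c where "\<And>k. k \<le> card N \<Longrightarrow> c k \<in> convex hull (layer N k)"
    and "(\<Sum>j\<in>J. z j *\<^sub>R c (a j)) \<in> coord_space N"
    and "\<And>i. i \<in> N \<Longrightarrow>
      Poly_Mapping.lookup (\<Sum>j\<in>J. z j *\<^sub>R c (a j)) i = Poly_Mapping.lookup x i"
proof -
  obtain r where r: "r \<in> coord_space N"
    and rx: "\<And>i. i \<in> N \<Longrightarrow> Poly_Mapping.lookup r i = Poly_Mapping.lookup x i"
    using restrict_exists[OF N, of x] by blast
  have "(\<Sum>j\<in>T. Poly_Mapping.lookup r j) = (\<Sum>j\<in>T. Poly_Mapping.lookup x j)" if "T \<subseteq> N" for T
    using that rx by (intro sum.cong) auto
  then have "block_constraints N r u"
    using block by (simp add: block_constraints_def psubset_imp_subset)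
  then have "r \<in> layer_combinations N u"
    using N r by (intro block_decomposition)
  then obtain c where c: "\<And>k. k \<le> card N \<Longrightarrow> c k \<in> convex hull (layer N k)"
    and rc: "r = (\<Sum>k=1..card N. Poly_Mapping.lookup u k *\<^sub>R c k)"
    by (auto simp: layer_combinations_def)
  have c0: "c 0 = 0"
    using c[of 0] layer_zero[OF N] by auto
  have "r = (\<Sum>k=1..card N. \<Sum>j\<in>J. (z j * Poly_Mapping.lookup (selector (a j)) k) *\<^sub>R c k)"
    by (simp add: rc u lookup_linear scaleR_sum_left)
  also have "\<dots> = (\<Sum>j\<in>J. \<Sum>k=1..card N. (z j * Poly_Mapping.lookup (selector (a j)) k) *\<^sub>R c k)"
    by (rule sum.swap)
  also have "\<dots> = (\<Sum>j\<in>J. z j *\<^sub>R c (a j))"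
  proof (rule sum.cong)
    fix j assume "j \<in> J"
    have "(\<Sum>k=1..card N. (z j * Poly_Mapping.lookup (selector (a j)) k) *\<^sub>R c k)
        = (\<Sum>k=1..card N. if k = a j then z j *\<^sub>R c k else 0)"
      by (intro sum.cong) (auto simp: lookup_selector)
    also have "\<dots> = z j *\<^sub>R c (a j)"
      using a[OF \<open>j \<in> J\<close>] c0 by (cases "a j = 0") auto
    finally show "(\<Sum>k=1..card N. (z j * Poly_Mapping.lookup (selector (a j)) k) *\<^sub>R c k)
        = z j *\<^sub>R c (a j)" .
  qed simp
  finally have "r = (\<Sum>j\<in>J. z j *\<^sub>R c (a j))" .
  with c r rx show thesis
    by (intro that[of c]) auto
qed

section \<open>The extended system\<close>

text \<open>
  With \<open>k\<close> ones in \<open>N\<close>, at most \<open>card N - card T\<close> of them lie outside \<open>T\<close>.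
\<close>

lemma block_constraints_selector:
  assumes N: "finite N" and bin: "\<And>j. j \<in> N \<Longrightarrow> Poly_Mapping.lookup x j \<in> {0, 1}"
    and k: "(\<Sum>j\<in>N. Poly_Mapping.lookup x j) = real k" "k \<le> card N"
  shows "block_constraints N x (selector k)"
  unfolding block_constraints_def
proof (intro conjI allI impI)
  show "(\<Sum>j\<in>N. Poly_Mapping.lookup x j) = weighted_sum (card N) (selector k)"
    using k by (simp add: weighted_sum_selector)
  fix T assume T: "T \<noteq> {} \<and> T \<subset> N"
  let ?K = "{k \<in> {1..card N}. card T + k > card N}"
  have lt: "card T < card N"
    using T N by (simp add: psubset_card_mono)
  have "(\<Sum>j\<in>N - T. Poly_Mapping.lookup x j) \<le> (\<Sum>j\<in>N - T. 1)"
    by (intro sum_mono) (use bin in force)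
  also have "\<dots> = real (card N) - real (card T)"
    using T N lt finite_subset[of T N] by (auto simp: card_Diff_subset of_nat_diff)
  finally have outside: "real k - (real (card N) - real (card T)) \<le> (\<Sum>j\<in>T. Poly_Mapping.lookup x j)"
    using k sum.subset_diff[of T N "Poly_Mapping.lookup x"] T N by auto
  have nonneg: "0 \<le> (\<Sum>j\<in>T. Poly_Mapping.lookup x j)"
    by (intro sum_nonneg) (use bin T in force)
  have "(\<Sum>i\<in>?K. (real (card T) + real i - real (card N)) * Poly_Mapping.lookup (selector k) i)
      = (\<Sum>i\<in>?K. if i = k then real (card T) + real i - real (card N) else 0)"
    by (intro sum.cong) (auto simp: lookup_selector)
  also have "\<dots> = (if k \<in> ?K then real (card T) + real k - real (card N) else 0)"
    by (simp add: sum.delta)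
  also have "\<dots> \<le> (\<Sum>j\<in>T. Poly_Mapping.lookup x j)"
    using outside nonneg by auto
  finally show "(\<Sum>i\<in>?K. (real (card T) + real i - real (card N)) * Poly_Mapping.lookup (selector k) i)
      \<le> (\<Sum>j\<in>T. Poly_Mapping.lookup x j)" .
qed

lemma sum_binary_eq_card:
  fixes h :: "'a \<Rightarrow> real"
  assumes "finite N" and "\<And>j. j \<in> N \<Longrightarrow> h j \<in> {0, 1}"
  obtains k where "k \<le> card N" "sum h N = real k"
proof
  have "sum h N = (\<Sum>j\<in>{j \<in> N. h j = 1}. 1)"
    using assms by (intro sum.mono_neutral_cong_right) auto
  then show "sum h N = real (card {j \<in> N. h j = 1})"
    by simp
  show "card {j \<in> N. h j = 1} \<le> card N"
    using assms by (intro card_mono) auto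
qed

lemma block_constraints_convex:
  assumes "block_constraints N x u" "block_constraints N x' u'" and "0 \<le> s" "0 \<le> t"
  shows "block_constraints N (s *\<^sub>R x + t *\<^sub>R x') (s *\<^sub>R u + t *\<^sub>R u')"
proof -
  have lin: "(\<Sum>i\<in>A. c i * Poly_Mapping.lookup (s *\<^sub>R f + t *\<^sub>R g) i)
      = s * (\<Sum>i\<in>A. c i * Poly_Mapping.lookup f i) + t * (\<Sum>i\<in>A. c i * Poly_Mapping.lookup g i)"
    for A and c :: "'i \<Rightarrow> real" and f g
    by (simp add: lookup_linear sum.distrib sum_distrib_left algebra_simps)
  have lin1: "(\<Sum>i\<in>A. Poly_Mapping.lookup (s *\<^sub>R f + t *\<^sub>R g) i)
      = s * (\<Sum>i\<in>A. Poly_Mapping.lookup f i) + t * (\<Sum>i\<in>A. Poly_Mapping.lookup g i)"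
    for A :: "'i set" and f g
    using lin[of "\<lambda>_. 1" f g A] by simp
  show ?thesis
    using assms unfolding block_constraints_def weighted_sum_def lin lin1
    by (simp add: add_mono mult_left_mono)
qed

lemma mem_extended_system:
  "(x, (y1, y2, y3), z) \<in> extended_system N1 N2 N3 p v \<longleftrightarrow>
    x \<in> coord_space (N1 \<union> N2 \<union> N3) \<and>
    y1 \<in> coord_space {1..card N1} \<and> y2 \<in> coord_space {1..card N2} \<and>
    y3 \<in> coord_space {1..card N3} \<and> z \<in> coord_space {1..p} \<and>
    (y1, y2, y3) = (\<Sum>j=1..p. Poly_Mapping.lookup z j *\<^sub>R v j) \<and>
    (\<Sum>j=1..p. Poly_Mapping.lookup z j) = 1 \<and>
    (\<forall>j\<in>{1..p}. Poly_Mapping.lookup z j \<ge> 0) \<and>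
    block_constraints N1 x y1 \<and> block_constraints N2 x y2 \<and> block_constraints N3 x y3"
  by (simp only: extended_system_def mem_Collect_eq prod.case)

lemma convex_extended_system: "convex (extended_system N1 N2 N3 p v)"
proof (rule convexI)
  fix q q' and s t :: real
  assume q: "q \<in> extended_system N1 N2 N3 p v" "q' \<in> extended_system N1 N2 N3 p v"
    and st: "0 \<le> s" "0 \<le> t" "s + t = 1"
  obtain x y1 y2 y3 z where q1: "q = (x, (y1, y2, y3), z)"
    by (cases q) auto
  obtain x' y1' y2' y3' z' where q2: "q' = (x', (y1', y2', y3'), z')"
    by (cases q') auto
  have parts: "x \<in> coord_space (N1 \<union> N2 \<union> N3)" "x' \<in> coord_space (N1 \<union> N2 \<union> N3)"
    "y1 \<in> coord_space {1..card N1}" "y1' \<in> coord_space {1..card N1}"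
    "y2 \<in> coord_space {1..card N2}" "y2' \<in> coord_space {1..card N2}"
    "y3 \<in> coord_space {1..card N3}" "y3' \<in> coord_space {1..card N3}"
    "z \<in> coord_space {1..p}" "z' \<in> coord_space {1..p}"
    "block_constraints N1 x y1" "block_constraints N1 x' y1'"
    "block_constraints N2 x y2" "block_constraints N2 x' y2'"
    "block_constraints N3 x y3" "block_constraints N3 x' y3'"
    using q unfolding q1 q2 mem_extended_system by blast+
  have coord: "s *\<^sub>R f + t *\<^sub>R g \<in> coord_space I" if "f \<in> coord_space I" "g \<in> coord_space I"
    for f g :: "'i \<Rightarrow>\<^sub>0 real" and I
    using that by (intro subspace_add subspace_mul subspace_coord_space)
  have "(\<Sum>j=1..p. Poly_Mapping.lookup (s *\<^sub>R z + t *\<^sub>R z') j *\<^sub>R v j)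
      = s *\<^sub>R (y1, y2, y3) + t *\<^sub>R (y1', y2', y3')"
    using q by (simp add: q1 q2 extended_system_def lookup_linear scaleR_add_left sum.distrib
        scaleR_sum_right)
  then have "(s *\<^sub>R y1 + t *\<^sub>R y1', s *\<^sub>R y2 + t *\<^sub>R y2', s *\<^sub>R y3 + t *\<^sub>R y3')
      = (\<Sum>j=1..p. Poly_Mapping.lookup (s *\<^sub>R z + t *\<^sub>R z') j *\<^sub>R v j)"
    by simp
  moreover have "(\<Sum>j=1..p. Poly_Mapping.lookup (s *\<^sub>R z + t *\<^sub>R z') j) = 1"
    using q st by (simp add: q1 q2 extended_system_def lookup_linear sum.distrib
        flip: sum_distrib_left)
  moreover have "\<forall>j\<in>{1..p}. 0 \<le> Poly_Mapping.lookup (s *\<^sub>R z + t *\<^sub>R z') j"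
    using q st by (simp add: q1 q2 extended_system_def lookup_linear)
  ultimately have "(s *\<^sub>R x + t *\<^sub>R x',
      (s *\<^sub>R y1 + t *\<^sub>R y1', s *\<^sub>R y2 + t *\<^sub>R y2', s *\<^sub>R y3 + t *\<^sub>R y3'), s *\<^sub>R z + t *\<^sub>R z')
      \<in> extended_system N1 N2 N3 p v"
    unfolding mem_extended_system using parts st
    by (intro conjI coord block_constraints_convex) assumption+
  then show "s *\<^sub>R q + t *\<^sub>R q' \<in> extended_system N1 N2 N3 p v"
    by (simp add: q1 q2)
qed

lemma knapsack_solutions_subset_projection:
  assumes fin: "finite N1" "finite N2" "finite N3"
    and v: "v ` {1..p} = aggregated_solutions (card N1) (card N2) (card N3) \<mu> lam \<sigma> \<beta>"
  shows "knapsack_solutions N1 N2 N3 \<mu> lam \<sigma> \<beta> \<subseteq> fst ` extended_system N1 N2 N3 p v"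
proof
  fix x assume x: "x \<in> knapsack_solutions N1 N2 N3 \<mu> lam \<sigma> \<beta>"
  have bin: "Poly_Mapping.lookup x j \<in> {0, 1}" if "j \<in> N1 \<union> N2 \<union> N3" for j
    using x that by (auto simp: knapsack_solutions_def binary_vectors_def)
  obtain a where a: "a \<le> card N1" "(\<Sum>j\<in>N1. Poly_Mapping.lookup x j) = real a"
    using sum_binary_eq_card[of N1 "Poly_Mapping.lookup x"] fin bin by blast
  obtain b where b: "b \<le> card N2" "(\<Sum>j\<in>N2. Poly_Mapping.lookup x j) = real b"
    using sum_binary_eq_card[of N2 "Poly_Mapping.lookup x"] fin bin by blast
  obtain c where c: "c \<le> card N3" "(\<Sum>j\<in>N3. Poly_Mapping.lookup x j) = real c"
    using sum_binary_eq_card[of N3 "Poly_Mapping.lookup x"] fin bin by blast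
  have "\<mu> * real a + lam * real b + \<sigma> * real c \<le> \<beta>"
    using x by (simp add: knapsack_solutions_def a b c flip: sum_distrib_left)
  then have "(selector a, selector b, selector c) \<in> v ` {1..p}"
    using v a b c by (simp add: aggregated_solutions_selector)
  then obtain l where l: "l \<in> {1..p}" "v l = (selector a, selector b, selector c)"
    by force
  define z where "z = Poly_Mapping.single l (1 :: real)"
  have lz: "Poly_Mapping.lookup z j = (if j = l then 1 else 0)" for j
    by (simp add: z_def lookup_single when_def)
  have "(\<Sum>j=1..p. Poly_Mapping.lookup z j *\<^sub>R v j) = (\<Sum>j=1..p. if j = l then v j else 0)"
    by (intro sum.cong) (auto simp: lz)
  then have "(\<Sum>j=1..p. Poly_Mapping.lookup z j *\<^sub>R v j) = (selector a, selector b, selector c)"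
    using l by simp
  moreover have "selector k \<in> coord_space {1..n}" if "k \<le> n" for k n
    using that by (auto simp: coord_space_iff lookup_selector)
  moreover have "z \<in> coord_space {1..p}" "(\<Sum>j=1..p. Poly_Mapping.lookup z j) = 1"
    using l by (auto simp: coord_space_iff lz)
  moreover have "x \<in> coord_space (N1 \<union> N2 \<union> N3)"
    using x by (simp add: knapsack_solutions_def binary_vectors_def)
  moreover have "block_constraints N1 x (selector a)" "block_constraints N2 x (selector b)"
      "block_constraints N3 x (selector c)"
    using fin bin a b c by (auto intro!: block_constraints_selector)
  ultimately have "(x, (selector a, selector b, selector c), z) \<in> extended_system N1 N2 N3 p v"
    using a b c by (simp add: extended_system_def lz)
  then show "x \<in> fst ` extended_system N1 N2 N3 p v"
    by force
qed

lemma layer_sum_subset_knapsack_solutions: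
  assumes disj: "N1 \<inter> N2 = {}" "N1 \<inter> N3 = {}" "N2 \<inter> N3 = {}"
    and le: "\<mu> * real a + lam * real b + \<sigma> * real c \<le> \<beta>"
  shows "layer N1 a + layer N2 b + layer N3 c \<subseteq> knapsack_solutions N1 N2 N3 \<mu> lam \<sigma> \<beta>"
proof
  fix h assume "h \<in> layer N1 a + layer N2 b + layer N3 c"
  then obtain f1 f2 f3 where f: "f1 \<in> layer N1 a" "f2 \<in> layer N2 b" "f3 \<in> layer N3 c"
    and h: "h = f1 + f2 + f3"
    by (auto elim!: set_plus_elim)
  have out: "\<And>i. i \<notin> N1 \<Longrightarrow> Poly_Mapping.lookup f1 i = 0"
      "\<And>i. i \<notin> N2 \<Longrightarrow> Poly_Mapping.lookup f2 i = 0" "\<And>i. i \<notin> N3 \<Longrightarrow> Poly_Mapping.lookup f3 i = 0"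
    using f by (auto simp: layer_def binary_vectors_def coord_space_iff)
  have h1: "Poly_Mapping.lookup h i = Poly_Mapping.lookup f1 i" if "i \<in> N1" for i
  proof -
    have "i \<notin> N2" "i \<notin> N3"
      using that disj by auto
    then show ?thesis
      using out by (simp add: h lookup_add)
  qed
  have h2: "Poly_Mapping.lookup h i = Poly_Mapping.lookup f2 i" if "i \<in> N2" for i
  proof -
    have "i \<notin> N1" "i \<notin> N3"
      using that disj by auto
    then show ?thesis
      using out by (simp add: h lookup_add)
  qed
  have h3: "Poly_Mapping.lookup h i = Poly_Mapping.lookup f3 i" if "i \<in> N3" for i
  proof -
    have "i \<notin> N1" "i \<notin> N2"
      using that disj by auto
    then show ?thesis
      using out by (simp add: h lookup_add)
  qed
  have "h \<in> coord_space (N1 \<union> N2 \<union> N3)"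
    using out by (auto simp: coord_space_iff h lookup_add)
  moreover have "Poly_Mapping.lookup h i \<in> {0, 1}" if "i \<in> N1 \<union> N2 \<union> N3" for i
    using that f h1[of i] h2[of i] h3[of i] by (auto simp: layer_def binary_vectors_def)
  moreover have "(\<Sum>j\<in>N1. Poly_Mapping.lookup h j) = real a"
      "(\<Sum>j\<in>N2. Poly_Mapping.lookup h j) = real b" "(\<Sum>j\<in>N3. Poly_Mapping.lookup h j) = real c"
    using f by (simp_all add: h1 h2 h3 layer_def)
  ultimately show "h \<in> knapsack_solutions N1 N2 N3 \<mu> lam \<sigma> \<beta>"
    using le by (simp add: knapsack_solutions_def binary_vectors_def flip: sum_distrib_left)
qed

lemma projection_subset_convex_hull:
  assumes fin: "finite N1" "finite N2" "finite N3"
    and disj: "N1 \<inter> N2 = {}" "N1 \<inter> N3 = {}" "N2 \<inter> N3 = {}"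
    and v: "v ` {1..p} \<subseteq> aggregated_solutions (card N1) (card N2) (card N3) \<mu> lam \<sigma> \<beta>"
  shows "fst ` extended_system N1 N2 N3 p v
    \<subseteq> convex hull (knapsack_solutions N1 N2 N3 \<mu> lam \<sigma> \<beta>)"
proof
  fix x assume "x \<in> fst ` extended_system N1 N2 N3 p v"
  then obtain y1 y2 y3 zz where x: "x \<in> coord_space (N1 \<union> N2 \<union> N3)"
    and y: "(y1, y2, y3) = (\<Sum>j=1..p. Poly_Mapping.lookup zz j *\<^sub>R v j)"
    and z1: "(\<Sum>j=1..p. Poly_Mapping.lookup zz j) = 1"
    and z0: "\<And>j. j \<in> {1..p} \<Longrightarrow> 0 \<le> Poly_Mapping.lookup zz j"
    and block: "block_constraints N1 x y1" "block_constraints N2 x y2" "block_constraints N3 x y3"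
    by (auto simp: extended_system_def)
  let ?z = "Poly_Mapping.lookup zz"
  have "\<forall>j\<in>{1..p}. \<exists>a b c. a \<le> card N1 \<and> b \<le> card N2 \<and> c \<le> card N3 \<and>
      v j = (selector a, selector b, selector c) \<and> \<mu> * real a + lam * real b + \<sigma> * real c \<le> \<beta>"
  proof
    fix j assume "j \<in> {1..p}"
    then have "v j \<in> aggregated_solutions (card N1) (card N2) (card N3) \<mu> lam \<sigma> \<beta>"
      using v by blast
    then show "\<exists>a b c. a \<le> card N1 \<and> b \<le> card N2 \<and> c \<le> card N3 \<and>
        v j = (selector a, selector b, selector c) \<and> \<mu> * real a + lam * real b + \<sigma> * real c \<le> \<beta>"
      by (elim aggregated_solutionsE) blast
  qed
  then obtain a b c where abc: "\<And>j. j \<in> {1..p} \<Longrightarrow> a j \<le> card N1 \<and> b j \<le> card N2 \<and> c j \<le> card N3 \<and>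
      v j = (selector (a j), selector (b j), selector (c j)) \<and>
      \<mu> * real (a j) + lam * real (b j) + \<sigma> * real (c j) \<le> \<beta>"
    by metis
  have "(y1, y2, y3)
      = (\<Sum>j=1..p. ?z j *\<^sub>R (selector (a j), selector (b j), selector (c j)))"
    unfolding y by (intro sum.cong) (use abc in auto)
  then have y1: "y1 = (\<Sum>j\<in>{1..p}. ?z j *\<^sub>R selector (a j))"
    and y2: "y2 = (\<Sum>j\<in>{1..p}. ?z j *\<^sub>R selector (b j))"
    and y3: "y3 = (\<Sum>j\<in>{1..p}. ?z j *\<^sub>R selector (c j))"
    by (simp_all add: prod_eq_iff fst_sum snd_sum)
  obtain f where f: "\<And>k. k \<le> card N1 \<Longrightarrow> f k \<in> convex hull (layer N1 k)"
    and f': "(\<Sum>j\<in>{1..p}. ?z j *\<^sub>R f (a j)) \<in> coord_space N1" "\<And>i. i \<in> N1 \<Longrightarrow>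
      Poly_Mapping.lookup (\<Sum>j\<in>{1..p}. ?z j *\<^sub>R f (a j)) i = Poly_Mapping.lookup x i"
    using block_decomposition_selectors[OF fin(1) block(1) y1] abc by blast
  obtain g where g: "\<And>k. k \<le> card N2 \<Longrightarrow> g k \<in> convex hull (layer N2 k)"
    and g': "(\<Sum>j\<in>{1..p}. ?z j *\<^sub>R g (b j)) \<in> coord_space N2" "\<And>i. i \<in> N2 \<Longrightarrow>
      Poly_Mapping.lookup (\<Sum>j\<in>{1..p}. ?z j *\<^sub>R g (b j)) i = Poly_Mapping.lookup x i"
    using block_decomposition_selectors[OF fin(2) block(2) y2] abc by blast
  obtain h where h: "\<And>k. k \<le> card N3 \<Longrightarrow> h k \<in> convex hull (layer N3 k)"
    and h': "(\<Sum>j\<in>{1..p}. ?z j *\<^sub>R h (c j)) \<in> coord_space N3" "\<And>i. i \<in> N3 \<Longrightarrow>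
      Poly_Mapping.lookup (\<Sum>j\<in>{1..p}. ?z j *\<^sub>R h (c j)) i = Poly_Mapping.lookup x i"
    using block_decomposition_selectors[OF fin(3) block(3) y3] abc by blast
  have x_eq: "x = (\<Sum>j\<in>{1..p}. ?z j *\<^sub>R f (a j)) + (\<Sum>j\<in>{1..p}. ?z j *\<^sub>R g (b j))
      + (\<Sum>j\<in>{1..p}. ?z j *\<^sub>R h (c j))" (is "x = ?F + ?G + ?H")
  proof (rule poly_mapping_eqI)
    fix i
    have out: "i \<notin> N1 \<Longrightarrow> Poly_Mapping.lookup ?F i = 0" "i \<notin> N2 \<Longrightarrow> Poly_Mapping.lookup ?G i = 0"
        "i \<notin> N3 \<Longrightarrow> Poly_Mapping.lookup ?H i = 0"
      using f'(1) g'(1) h'(1) unfolding coord_space_iff by blast+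
    consider "i \<in> N1" "i \<notin> N2" "i \<notin> N3" | "i \<notin> N1" "i \<in> N2" "i \<notin> N3" | "i \<notin> N1" "i \<notin> N2" "i \<in> N3"
      | "i \<notin> N1" "i \<notin> N2" "i \<notin> N3"
      using disj by blast
    then show "Poly_Mapping.lookup x i = Poly_Mapping.lookup (?F + ?G + ?H) i"
    proof cases
      case 1
      then show ?thesis using out f'(2) by (simp only: lookup_add) simp
    next
      case 2
      then show ?thesis using out g'(2) by (simp only: lookup_add) simp
    next
      case 3
      then show ?thesis using out h'(2) by (simp only: lookup_add) simp
    next
      case 4
      then show ?thesis using out x by (simp only: lookup_add) (simp add: coord_space_iff)
    qed
  qed
  also have "\<dots> = (\<Sum>j\<in>{1..p}. ?z j *\<^sub>R (f (a j) + g (b j) + h (c j)))"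
    by (simp add: scaleR_add_right sum.distrib)
  also have "\<dots> \<in> convex hull (knapsack_solutions N1 N2 N3 \<mu> lam \<sigma> \<beta>)"
  proof (rule convex_sum)
    fix j assume j: "j \<in> {1..p}"
    have "f (a j) + g (b j) + h (c j)
        \<in> convex hull (layer N1 (a j) + layer N2 (b j) + layer N3 (c j))"
      using abc[OF j] f g h unfolding convex_hull_set_plus by (intro set_plus_intro) auto
    also have "\<dots> \<subseteq> convex hull (knapsack_solutions N1 N2 N3 \<mu> lam \<sigma> \<beta>)"
      using abc[OF j] disj by (intro hull_mono layer_sum_subset_knapsack_solutions) auto
    finally show "f (a j) + g (b j) + h (c j)
        \<in> convex hull (knapsack_solutions N1 N2 N3 \<mu> lam \<sigma> \<beta>)" .
  qed (use z0 z1 in auto)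
  finally show "x \<in> convex hull (knapsack_solutions N1 N2 N3 \<mu> lam \<sigma> \<beta>)" .
qed

theorem mainTheorem4:
  fixes N1 N2 N3 :: "'a set"
    and \<mu> lam \<sigma> \<beta> :: real
    and p :: nat
    and v :: "nat \<Rightarrow> blocks"
  assumes "finite N1" and "finite N2" and "finite N3"
    and "N1 \<inter> N2 = {}" and "N1 \<inter> N3 = {}" and "N2 \<inter> N3 = {}"
    and "\<mu> \<noteq> lam" and "\<mu> \<noteq> \<sigma>" and "lam \<noteq> \<sigma>"
    and "bij_betw v {1..p}
      {w. w extreme_point_of
        aggregated_polyhedron (card N1) (card N2) (card N3) \<mu> lam \<sigma> \<beta>}"
  shows "convex hull (knapsack_solutions N1 N2 N3 \<mu> lam \<sigma> \<beta>)
    = fst ` extended_system N1 N2 N3 p v"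
proof
  have v: "v ` {1..p} = aggregated_solutions (card N1) (card N2) (card N3) \<mu> lam \<sigma> \<beta>"
    using assms(10) unfolding extreme_points_aggregated_polyhedron by (simp add: bij_betw_def)
  show "convex hull (knapsack_solutions N1 N2 N3 \<mu> lam \<sigma> \<beta>) \<subseteq> fst ` extended_system N1 N2 N3 p v"
    by (intro hull_minimal knapsack_solutions_subset_projection convex_linear_image
        linear_fst convex_extended_system assms v)
  show "fst ` extended_system N1 N2 N3 p v \<subseteq> convex hull (knapsack_solutions N1 N2 N3 \<mu> lam \<sigma> \<beta>)"
    using v by (intro projection_subset_convex_hull assms) simp
qed

end
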